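(* Let $1<k\le n$, $\sigma\in S^k_n$, and assume $\mathrm{sign}(a_{\mathbf{e}_{\sigma(j)}}a_{\mathbf{e}_{\sigma(i)}})=1$ for all $1\le i<j\le k$ (case $s=1$). Let $v_k(\nu_0)$ denote the $2k$-cell vector field obtained by restricting to $\overline{\mathcal{M}_{k,\sigma}}$ the vector field $$v=\sum_{i=1}^n\Big(\nu_0+\sum_{j=1}^na_{\mathbf{e}_j}(x_j^2+y_j^2)\Big)\Big(x_i\frac{\partial}{\partial x_i}+y_i\frac{\partial}{\partial y_i}\Big).$$ Then the parametric $2k$-cell vector fields $v_k(\nu_0^1)$ and $v_k(\nu_0^2)$ are orbitally equivalent whenever either $\nu_0^1,\nu_0^2\in\{\nu_0:\nu_0>0\}$ or $\nu_0^1,\nu_0^2\in\{\nu_0:\nu_0<0\}$. Hence, the variety $\{\nu_0:\nu_0=0\}$ is the only $2k$-cell bifurcation variety for the $2k$-cell truncated normal form system.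
   Context: $S^k_n$ is the set of permutations $\sigma$ of $\{1,\dots,n\}$ with $\sigma(i)<\sigma(j)$ for $i<j\le k$ and for $k<i<j\le n$. $\mathcal{M}_{k,\sigma}=\{\mathbf{x}=(x_1,y_1,\dots,x_n,y_n)\in\mathbb{R}^{2n}:(x_{\sigma(i)},y_{\sigma(i)})\ne0\ (i\le k),\ =0\ (i>k)\}$, with closure $\overline{\mathcal{M}_{k,\sigma}}$. $a_{\mathbf{e}_j}$ are real constants and $\nu_0$ is a real parameter; the full truncated normal form is $\Theta+v$ with $\Theta=\sum_i\omega_i(-y_i\partial_{x_i}+x_i\partial_{y_i})$, all $\omega_i\neq0$, $\omega_i/\omega_j\notin\mathbb{Q}$ for $i<j$. The case $s=1$ means that the cubic coefficient of the amplitude equation on the invariant leaves is nonzero. Two vector fields are orbitally equivalent if a homeomorphism carries the orbits of one to those of the other, up to an orientation-preserving time reparametrization. A $2k$-cell bifurcation variety is the set of parameters where the qualitative dynamics on $\overline{\mathcal{M}_{k,\sigma}}$ changes. *)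

theory Defs
  imports "HOL-Analysis.Analysis"
begin

text \<open>
  The index set \<open>{1, \<dots>, n}\<close> is a finite linearly ordered type \<open>'n\<close>, with \<open>n = CARD('n)\<close>; an index is
  compared with the number \<open>k\<close> through its position. A point of \<open>\<real>\<^sup>2\<^sup>n\<close> is a vector \<open>x\<close> with
  \<open>x $ i = (x\<^sub>i, y\<^sub>i)\<close>.
\<close>

definition pos :: "'n::{finite,linorder} \<Rightarrow> nat"
  where "pos i = card {..i}"

definition block_increasing_perms :: "nat \<Rightarrow> ('n::{finite,linorder} \<Rightarrow> 'n) set"
  where "block_increasing_perms k =
    {\<sigma>. bij \<sigma> \<and>
        (\<forall>i j. i < j \<and> pos j \<le> k \<longrightarrow> \<sigma> i < \<sigma> j) \<and>
        (\<forall>i j. k < pos i \<and> i < j \<longrightarrow> \<sigma> i < \<sigma> j)}"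

definition cell :: "nat \<Rightarrow> ('n \<Rightarrow> 'n) \<Rightarrow> ((real \<times> real) ^ 'n::{finite,linorder}) set"
  where "cell k \<sigma> = {x. \<forall>i. (pos i \<le> k \<longrightarrow> x $ \<sigma> i \<noteq> 0) \<and> (pos i > k \<longrightarrow> x $ \<sigma> i = 0)}"

definition Theta :: "('n \<Rightarrow> real) \<Rightarrow> (real \<times> real) ^ 'n::{finite,linorder} \<Rightarrow> (real \<times> real) ^ 'n::{finite,linorder}"
  where "Theta \<omega> x = (\<chi> i. (- \<omega> i * snd (x $ i), \<omega> i * fst (x $ i)))"

definition vfield ::
    "('n \<Rightarrow> real) \<Rightarrow> real \<Rightarrow> (real \<times> real) ^ 'n::{finite,linorder} \<Rightarrow> (real \<times> real) ^ 'n::{finite,linorder}"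
  where "vfield a \<nu> x =
    (\<chi> i. (\<nu> + (\<Sum>j\<in>UNIV. a j * ((fst (x $ j))\<^sup>2 + (snd (x $ j))\<^sup>2))) *\<^sub>R (x $ i))"

text \<open>
  The vector field preserves the ratios of the radii, so the invariant leaves of \<^term>\<open>cell k \<sigma>\<close> are
  the sets where the radius of the component \<open>\<sigma> i\<close> is \<open>c i * \<rho>\<close> for all \<open>i\<close> with \<^term>\<open>pos i \<le> k\<close>,
  with fixed \<open>c i > 0\<close> and varying amplitude \<open>\<rho> > 0\<close>. On such a leaf the amplitude equation is
  \<open>\<rho>' = \<rho> * (\<nu> + leaf_cubic_coeff a k \<sigma> c * \<rho>\<^sup>2)\<close>.
\<close>

definition leaf_cubic_coeff ::
    "('n \<Rightarrow> real) \<Rightarrow> nat \<Rightarrow> ('n::{finite,linorder} \<Rightarrow> 'n) \<Rightarrow> ('n \<Rightarrow> real) \<Rightarrow> real"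
  where "leaf_cubic_coeff a k \<sigma> c = (\<Sum>i | pos i \<le> k. a (\<sigma> i) * (c i)\<^sup>2)"

definition cubic_case :: "('n \<Rightarrow> real) \<Rightarrow> nat \<Rightarrow> ('n::{finite,linorder} \<Rightarrow> 'n) \<Rightarrow> bool"
  where "cubic_case a k \<sigma> \<longleftrightarrow>
    (\<forall>c. (\<forall>i. pos i \<le> k \<longrightarrow> c i > 0) \<longrightarrow> leaf_cubic_coeff a k \<sigma> c \<noteq> 0)"

text \<open>
  Orbits of a vector field \<open>F\<close> on \<open>S\<close> are the images of its maximal integral curves. These need not be
  complete: solutions may blow up in finite time.
\<close>

definition integral_curve ::
    "'a::real_normed_vector set \<Rightarrow> ('a \<Rightarrow> 'a) \<Rightarrow> real set \<Rightarrow> (real \<Rightarrow> 'a) \<Rightarrow> bool"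
  where "integral_curve S F I \<gamma> \<longleftrightarrow>
    open I \<and> is_interval I \<and> I \<noteq> {} \<and>
    (\<forall>t\<in>I. \<gamma> t \<in> S \<and> (\<gamma> has_vector_derivative F (\<gamma> t)) (at t))"

definition maximal_integral_curve ::
    "'a::real_normed_vector set \<Rightarrow> ('a \<Rightarrow> 'a) \<Rightarrow> real set \<Rightarrow> (real \<Rightarrow> 'a) \<Rightarrow> bool"
  where "maximal_integral_curve S F I \<gamma> \<longleftrightarrow>
    integral_curve S F I \<gamma> \<and>
    (\<forall>J \<delta>. integral_curve S F J \<delta> \<and> I \<subseteq> J \<and> (\<forall>t\<in>I. \<delta> t = \<gamma> t) \<longrightarrow> J = I)"

text \<open>
  The time change \<open>\<tau>\<close> below, being a strictly increasing map of an interval onto an interval, is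
  automatically a homeomorphism.
\<close>

definition carries_orbits ::
    "'a::real_normed_vector set \<Rightarrow> ('a \<Rightarrow> 'a) \<Rightarrow> ('a \<Rightarrow> 'a) \<Rightarrow> ('a \<Rightarrow> 'a) \<Rightarrow> bool"
  where "carries_orbits S F G h \<longleftrightarrow>
    (\<forall>I \<gamma>. maximal_integral_curve S F I \<gamma> \<longrightarrow>
      (\<exists>J \<delta> \<tau>. maximal_integral_curve S G J \<delta> \<and>
        strict_mono_on I \<tau> \<and> \<tau> ` I = J \<and> (\<forall>t\<in>I. h (\<gamma> t) = \<delta> (\<tau> t))))"

definition orbitally_equivalent ::
    "'a::real_normed_vector set \<Rightarrow> ('a \<Rightarrow> 'a) \<Rightarrow> ('a \<Rightarrow> 'a) \<Rightarrow> bool"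
  where "orbitally_equivalent S F G \<longleftrightarrow>
    (\<exists>h h'. homeomorphism S S h h' \<and> carries_orbits S F G h \<and> carries_orbits S G F h')"

text \<open>
  The parameters at which the qualitative dynamics on \<open>S\<close> changes: those without a neighbourhood on
  which all members of the family are orbitally equivalent to the given one.
\<close>

definition bifurcation_variety ::
    "'a::real_normed_vector set \<Rightarrow> (real \<Rightarrow> 'a \<Rightarrow> 'a) \<Rightarrow> real set"
  where "bifurcation_variety S F =
    {\<nu>. \<not> (\<forall>\<^sub>F \<mu> in nhds \<nu>. orbitally_equivalent S (F \<nu>) (F \<mu>))}"

text \<open>Coefficients of equal sign on the cell already put us in the cubic case.\<close>

lemma cubic_caseI:
  fixes \<sigma> :: "'n::{finite,linorder} \<Rightarrow> 'n"
  assumes "1 < k" "k \<le> CARD('n)"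
    and "\<And>i j. i < j \<Longrightarrow> pos j \<le> k \<Longrightarrow> sgn (a (\<sigma> j) * a (\<sigma> i)) = 1"
  shows "cubic_case a k \<sigma>"
  unfolding cubic_case_def
proof (intro allI impI)
  fix c :: "'n \<Rightarrow> real" assume c: "\<forall>i. pos i \<le> k \<longrightarrow> c i > 0"
  define m where "m = Min (UNIV :: 'n set)"
  have m_le: "m \<le> i" for i by (simp add: m_def)
  have "{..m} = {m}" using m_le by (auto intro: antisym)
  then have pm: "pos m \<le> k" using assms(1) by (simp add: pos_def)
  have CARD1: "1 < CARD('n)" using assms by linarith
  define m2 where "m2 = Min (UNIV - {m})"
  have ne: "UNIV - {m} \<noteq> {}"
  proof
    assume "UNIV - {m} = {}"
    then have "(UNIV::'n set) = {m}" by auto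
    then have "CARD('n) = 1" by (metis card_1_singleton_iff One_nat_def)
    then show False using CARD1 by simp
  qed
  have m2: "m2 \<noteq> m" "\<And>i. i \<noteq> m \<Longrightarrow> m2 \<le> i"
    using Min_in[OF _ ne] by (auto simp: m2_def)
  have "{..m2} \<subseteq> {m, m2}" using m2(2) by (auto intro: antisym)
  then have "pos m2 \<le> card {m, m2}" unfolding pos_def by (intro card_mono) auto
  also have "\<dots> \<le> 2" by (simp add: card_insert_if)
  finally have pm2: "pos m2 \<le> k" using assms(1) by simp
  have "m < m2" using m_le[of m2] m2(1) by simp
  from assms(3)[OF this pm2] have am: "a (\<sigma> m) \<noteq> 0" by auto
  have pp: "a (\<sigma> m) * a (\<sigma> i) > 0" if "pos i \<le> k" for i
  proof (cases "i = m")
    case True then show ?thesis using am by (auto simp: zero_less_mult_iff linorder_neq_iff)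
  next
    case False
    then have "m < i" using m_le[of i] by simp
    from assms(3)[OF this that] show ?thesis by (simp add: sgn_1_pos mult.commute)
  qed
  have "0 < (\<Sum>i | pos i \<le> k. a (\<sigma> m) * (a (\<sigma> i) * (c i)\<^sup>2))"
  proof (rule sum_pos)
    fix i :: 'n assume "i \<in> {i. pos i \<le> k}"
    then show "0 < a (\<sigma> m) * (a (\<sigma> i) * (c i)\<^sup>2)"
      using mult_pos_pos[of "a (\<sigma> m) * a (\<sigma> i)" "(c i)\<^sup>2"] pp[of i] c by (fastforce simp: mult.assoc)
  qed (use pm in auto)
  then show "leaf_cubic_coeff a k \<sigma> c \<noteq> 0"
    by (auto simp: leaf_cubic_coeff_def simp flip: sum_distrib_left)
qed

end

theory Submission
  imports Defs
begin

text \<open>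
  On the closed cell, a coordinate subspace, the coefficients \<open>a j\<close> have a common sign, so the
  signed amplitude \<open>A x = (\<Sum>j. a j * \<bar>x j\<bar>\<^sup>2)\<close> vanishes only at the origin. Adding the
  rotation \<open>\<Theta>\<close> does not affect \<open>A\<close>: along the orbits of \<open>\<Theta> + v\<close> as along those of \<open>v\<close>,
  \<open>A' = 2 (\<nu> + A) A\<close>. Both families are therefore treated at once, \<open>v\<close> being the case \<open>\<omega> = 0\<close>.

  For \<open>v\<close> alone a linear rescaling would relate two parameters of the same sign, but it changes
  the radial speed along the orbits while that of the rotation is fixed. A conjugacy
  \<open>x \<mapsto> m (A x) x\<close> that preserves time is used instead: it commutes with the rotations, so
  only the scalar equation for \<open>A\<close> matters. In \<open>w = 1 / A\<close> this equation is affine,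
  \<open>w' = -2 (\<nu> w + 1)\<close>, and the power of exponent \<open>\<nu>2 / \<nu>1\<close> (with sign) applied to \<open>\<nu>1 w + 1\<close>
  conjugates the two affine equations, cycles of equilibrium amplitude and blow-up times included.
  That the resulting map sends integral curves to integral curves is
  \<open>integral_curve_conjugacy\<close>; that it is a homeomorphism up to the origin follows from
  definiteness of \<open>A\<close> in \<open>continuous_amplitude_conjugacy\<close>. This gives equivalence of all parameters of
  one sign, in particular of all parameters near a given \<open>\<nu> \<noteq> 0\<close>.

  At \<open>\<nu> = 0\<close>, every orbit other than the origin is unbounded, since \<open>A' = 2 A\<^sup>2\<close> blows up in
  finite time (\<open>maximal_blow_up_curve\<close>). For the nonzero parameters \<open>\<nu>\<close> of sign opposite to that of
  \<open>A\<close>, however, the set \<open>A = -\<nu>\<close> is a compact union of orbits with more than one point. An equivalence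
  would carry the orbit of some nonzero point into this compact set
  (\<open>not_orbitally_equivalent_zero\<close>). As such \<open>\<nu>\<close> exist arbitrarily close to \<open>0\<close>, the parameter
  \<open>0\<close> is a bifurcation.
\<close>

section \<open>Preliminaries from real analysis\<close>

lemma has_vector_derivative_vec_componentwise:
  fixes f :: "real \<Rightarrow> 'a::real_normed_vector ^ 'n"
  assumes "\<And>i. ((\<lambda>t. f t $ i) has_vector_derivative f' $ i) (at t)"
  shows "(f has_vector_derivative f') (at t)"
  unfolding has_vector_derivative_def has_derivative_def
proof
  show "bounded_linear (\<lambda>x. x *\<^sub>R f')" by (rule bounded_linear_scaleR_left)
  show "((\<lambda>y. (f y - f (netlimit (at t)) - (y - netlimit (at t)) *\<^sub>R f') /\<^sub>R norm (y - netlimit (at t))) \<longlongrightarrow> 0) (at t)"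
    using assms by (intro vec_tendstoI) (simp add: has_vector_derivative_def has_derivative_def)
qed

text \<open>
  Multiplying \<open>f\<close> by the integrating factor \<open>exp (- \<integral> b)\<close> makes it constant.
\<close>
lemma linear_ode_zero:
  fixes f b :: "real \<Rightarrow> real"
  assumes I: "is_interval I" "t0 \<in> I" "t1 \<in> I"
    and b: "continuous_on I b"
    and f: "\<And>t. t \<in> I \<Longrightarrow> (f has_real_derivative b t * f t) (at t)"
    and f0: "f t0 = 0"
  shows "f t1 = 0"
proof -
  define J where "J = {min t0 t1..max t0 t1}"
  have "{min t0 t1, max t0 t1} \<subseteq> I" using I by (auto simp: min_def max_def)
  then have sub: "J \<subseteq> I" using I(1) unfolding J_def is_interval_1 by fastforce
  define B where "B t = integral {min t0 t1..t} b" for t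
  have B: "(B has_real_derivative b t) (at t within J)" if "t \<in> J" for t
    unfolding B_def has_real_derivative_iff_has_vector_derivative J_def
    using that continuous_on_subset[OF b sub] by (intro integral_has_vector_derivative) (auto simp: J_def)
  have "((\<lambda>t. f t * exp (- B t)) has_real_derivative 0) (at t within J)" if "t \<in> J" for t
    using has_field_derivative_at_within[OF f] that sub B[OF that]
    by (auto intro!: derivative_eq_intros)
  then obtain c where c: "\<forall>t\<in>J. f t * exp (- B t) = c"
    using has_field_derivative_zero_constant[of J "\<lambda>t. f t * exp (- B t)"] by (auto simp: J_def)
  have "t0 \<in> J" "t1 \<in> J" by (auto simp: J_def)
  then have "f t1 * exp (- B t1) = f t0 * exp (- B t0)" using c by metis
  with f0 show ?thesis by simp
qed

definition signed_powr :: "real \<Rightarrow> real \<Rightarrow> real"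
  where "signed_powr p u = sgn u * \<bar>u\<bar> powr p"

lemma signed_powr_inverse:
  assumes "p * q = 1"
  shows "signed_powr q (signed_powr p u) = u"
  using assms by (auto simp: signed_powr_def sgn_mult abs_mult powr_powr sgn_if)

lemma signed_powr_one [simp]: "signed_powr p 1 = 1"
  by (simp add: signed_powr_def)

lemma signed_powr_mult_pos:
  assumes "0 < e"
  shows "signed_powr p (u * e) = signed_powr p u * e powr p"
  using assms by (simp add: signed_powr_def sgn_mult abs_mult powr_mult)

lemma abs_signed_powr: "\<bar>signed_powr p u\<bar> = \<bar>u\<bar> powr p"
  by (simp add: signed_powr_def abs_mult sgn_if)

lemma signed_powr_gt_one: "0 < p \<Longrightarrow> 1 < u \<Longrightarrow> 1 < signed_powr p u"
  by (simp add: signed_powr_def)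

lemma signed_powr_less_one:
  assumes "0 < p" "u < 1"
  shows "signed_powr p u < 1"
proof (cases "0 < u")
  case True
  then show ?thesis using powr_less_mono2[of p u 1] assms by (simp add: signed_powr_def)
next
  case False
  then have "signed_powr p u \<le> 0" by (simp add: signed_powr_def sgn_if)
  then show ?thesis by simp
qed

text \<open>
  The formula with \<^const>\<open>sgn\<close> hides the continuity at 0; as a difference of powers of the
  positive and negative parts it is visible.
\<close>
lemma continuous_signed_powr:
  assumes "0 < p"
  shows "isCont (signed_powr p) u"
proof -
  have "signed_powr p = (\<lambda>u. (max u 0) powr p - (max (- u) 0) powr p)"
    using assms by (auto simp: signed_powr_def fun_eq_iff max_def sgn_if)
  moreover have "continuous_on UNIV (\<lambda>u::real. (max u 0) powr p - (max (- u) 0) powr p)"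
    using assms by (intro continuous_on_diff continuous_on_powr' continuous_intros) auto
  ultimately show ?thesis by (simp add: continuous_on_eq_continuous_at)
qed

lemma signed_powr_at_infinity:
  assumes "0 < p"
  shows "filterlim (signed_powr p) at_infinity at_infinity"
proof -
  have "filterlim (\<lambda>x::real. x powr p) at_top at_top"
  proof (rule filterlim_at_top_mono)
    show "filterlim (\<lambda>x. exp (p * ln x)) at_top at_top"
      by (intro filterlim_compose[OF exp_at_top] filterlim_tendsto_pos_mult_at_top[OF tendsto_const assms] ln_at_top)
    show "\<forall>\<^sub>F x in at_top. exp (p * ln x) \<le> x powr p"
      using eventually_gt_at_top[of 0] by eventually_elim (simp add: powr_def)
  qed
  then have "filterlim (\<lambda>u::real. norm u powr p) at_top at_infinity"
    by (rule filterlim_compose) (rule filterlim_norm_at_top)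
  then show ?thesis
    by (simp add: filterlim_at_infinity_conv_norm_at_top abs_signed_powr)
qed

section \<open>The normal form on coordinate subspaces\<close>

definition amplitude :: "('n \<Rightarrow> real) \<Rightarrow> (real \<times> real) ^ 'n::{finite,linorder} \<Rightarrow> real"
  where "amplitude a x = (\<Sum>j\<in>UNIV. a j * (norm (x $ j))\<^sup>2)"

text \<open>
  The full truncated normal form; frequencies \<open>\<omega> = 0\<close> give \<^const>\<open>vfield\<close> itself.
\<close>
definition normal_form ::
    "('n \<Rightarrow> real) \<Rightarrow> ('n \<Rightarrow> real) \<Rightarrow> real \<Rightarrow> (real \<times> real) ^ 'n::{finite,linorder} \<Rightarrow> (real \<times> real) ^ 'n::{finite,linorder}"
  where "normal_form \<omega> a \<nu> x = Theta \<omega> x + vfield a \<nu> x"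

definition coord_subspace :: "'n set \<Rightarrow> ((real \<times> real) ^ 'n::{finite,linorder}) set"
  where "coord_subspace L = {x. \<forall>j. j \<notin> L \<longrightarrow> x $ j = 0}"

text \<open>The flow of \<^const>\<open>Theta\<close>.\<close>
definition rotation :: "('n \<Rightarrow> real) \<Rightarrow> real \<Rightarrow> (real \<times> real) ^ 'n::{finite,linorder} \<Rightarrow> (real \<times> real) ^ 'n::{finite,linorder}"
  where "rotation \<omega> t x = (\<chi> j. (cos (\<omega> j * t) * fst (x $ j) - sin (\<omega> j * t) * snd (x $ j),
                              sin (\<omega> j * t) * fst (x $ j) + cos (\<omega> j * t) * snd (x $ j)))"

lemma norm_square_pair: "(norm (z :: real \<times> real))\<^sup>2 = (fst z)\<^sup>2 + (snd z)\<^sup>2"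
  by (simp add: norm_prod_def)

lemma normal_form_eq: "normal_form \<omega> a \<nu> x = Theta \<omega> x + (\<nu> + amplitude a x) *\<^sub>R x"
  by (simp add: normal_form_def vfield_def amplitude_def norm_square_pair vec_eq_iff)

lemma normal_form_no_rotation: "normal_form (\<lambda>_. 0) a \<nu> = vfield a \<nu>"
  by (simp add: normal_form_def Theta_def fun_eq_iff vec_eq_iff zero_prod_def)

lemma Theta_scaleR: "Theta \<omega> (c *\<^sub>R x) = c *\<^sub>R Theta \<omega> x"
  by (simp add: Theta_def vec_eq_iff)

lemma normal_form_zero: "normal_form \<omega> a \<nu> 0 = 0"
  by (simp add: normal_form_eq Theta_def vec_eq_iff zero_prod_def)

lemma amplitude_scaleR: "amplitude a (c *\<^sub>R x) = c\<^sup>2 * amplitude a x"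
  by (simp add: amplitude_def power_mult_distrib sum_distrib_left mult_ac)

lemma amplitude_zero [simp]: "amplitude a 0 = 0"
  by (simp add: amplitude_def)

lemma continuous_on_amplitude: "continuous_on T (amplitude a)"
  unfolding amplitude_def by (intro continuous_intros)

lemma amplitude_rotation: "amplitude a (rotation \<omega> t x) = amplitude a x"
proof -
  have "(c * p - s * q)\<^sup>2 + (s * p + c * q)\<^sup>2 = (c\<^sup>2 + s\<^sup>2) * (p\<^sup>2 + q\<^sup>2)" for c s p q :: real
    by algebra
  then show ?thesis
    by (simp add: amplitude_def rotation_def norm_square_pair)
qed

lemma has_vector_derivative_rotation:
  "((\<lambda>t. rotation \<omega> t x) has_vector_derivative Theta \<omega> (rotation \<omega> t x)) (at t)"
  unfolding rotation_def Theta_def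
  by (rule has_vector_derivative_vec_componentwise)
    (auto intro!: derivative_eq_intros has_vector_derivative_Pair
      simp flip: has_real_derivative_iff_has_vector_derivative simp: algebra_simps)

text \<open>
  The rotational part is orthogonal to each component and so drops out; the rest is radial and
  multiplies the quadratic form by twice its rate.
\<close>
lemma has_real_derivative_amplitude:
  assumes \<gamma>: "(\<gamma> has_vector_derivative normal_form \<omega> a \<nu> (\<gamma> t)) (at t)"
  shows "((\<lambda>t. amplitude a (\<gamma> t)) has_real_derivative
           2 * (\<nu> + amplitude a (\<gamma> t)) * amplitude a (\<gamma> t)) (at t)"
proof -
  define g where "g = \<nu> + amplitude a (\<gamma> t)"
  have nf: "normal_form \<omega> a \<nu> (\<gamma> t) = Theta \<omega> (\<gamma> t) + g *\<^sub>R \<gamma> t"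
    by (simp add: normal_form_eq g_def)
  have comp: "((\<lambda>t. \<gamma> t $ j) has_vector_derivative normal_form \<omega> a \<nu> (\<gamma> t) $ j) (at t)" for j
    by (rule bounded_linear.has_vector_derivative[OF bounded_linear_vec_nth \<gamma>])
  have f: "((\<lambda>t. fst (\<gamma> t $ j)) has_real_derivative - \<omega> j * snd (\<gamma> t $ j) + g * fst (\<gamma> t $ j)) (at t)" for j
    using bounded_linear.has_vector_derivative[OF bounded_linear_fst comp[of j]]
    by (simp add: has_real_derivative_iff_has_vector_derivative nf Theta_def)
  have s: "((\<lambda>t. snd (\<gamma> t $ j)) has_real_derivative \<omega> j * fst (\<gamma> t $ j) + g * snd (\<gamma> t $ j)) (at t)" for j
    using bounded_linear.has_vector_derivative[OF bounded_linear_snd comp[of j]]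
    by (simp add: has_real_derivative_iff_has_vector_derivative nf Theta_def)
  have "((\<lambda>t. a j * (norm (\<gamma> t $ j))\<^sup>2) has_real_derivative 2 * g * (a j * (norm (\<gamma> t $ j))\<^sup>2)) (at t)" for j
    unfolding norm_square_pair
    by (auto intro!: derivative_eq_intros f s simp: power2_eq_square algebra_simps)
  then have "((\<lambda>t. amplitude a (\<gamma> t)) has_real_derivative (\<Sum>j\<in>UNIV. 2 * g * (a j * (norm (\<gamma> t $ j))\<^sup>2))) (at t)"
    unfolding amplitude_def by (intro DERIV_sum)
  then show ?thesis by (simp add: amplitude_def g_def sum_distrib_left)
qed

lemma closed_coord_subspace: "closed (coord_subspace L)"
proof -
  have "coord_subspace L = (\<Inter>j\<in>-L. {x. x $ j = 0})" by (auto simp: coord_subspace_def)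
  then show ?thesis by (auto intro!: closed_INT closed_Collect_eq continuous_intros)
qed

lemma scaleR_coord_subspace: "x \<in> coord_subspace L \<Longrightarrow> c *\<^sub>R x \<in> coord_subspace L"
  by (simp add: coord_subspace_def)

lemma rotation_coord_subspace: "x \<in> coord_subspace L \<Longrightarrow> rotation \<omega> t x \<in> coord_subspace L"
  by (simp add: coord_subspace_def rotation_def zero_prod_def)

lemma closure_cell:
  fixes \<sigma> :: "'n::{finite,linorder} \<Rightarrow> 'n"
  assumes "bij \<sigma>"
  shows "closure (cell k \<sigma>) = coord_subspace (\<sigma> ` {i. pos i \<le> k})"
proof
  have "cell k \<sigma> \<subseteq> coord_subspace (\<sigma> ` {i. pos i \<le> k})"
  proof
    fix x assume x: "x \<in> cell k \<sigma>"
    have "x $ j = 0" if "j \<notin> \<sigma> ` {i. pos i \<le> k}" for j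
    proof -
      obtain i where "j = \<sigma> i" using assms by (meson bij_pointE)
      with that x show ?thesis by (fastforce simp: cell_def)
    qed
    then show "x \<in> coord_subspace (\<sigma> ` {i. pos i \<le> k})" by (simp add: coord_subspace_def)
  qed
  then show "closure (cell k \<sigma>) \<subseteq> coord_subspace (\<sigma> ` {i. pos i \<le> k})"
    by (rule closure_minimal[OF _ closed_coord_subspace])
  show "coord_subspace (\<sigma> ` {i. pos i \<le> k}) \<subseteq> closure (cell k \<sigma>)"
  proof
    fix x assume x: "x \<in> coord_subspace (\<sigma> ` {i. pos i \<le> k})"
    \<comment> \<open>Push the vanishing components of the cell off zero by a vanishing amount.\<close>
    define y where "y m = (\<chi> j. if j \<in> \<sigma> ` {i. pos i \<le> k} \<and> x $ j = 0
      then (inverse (real (Suc m)), 0) else x $ j)" for m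
    have "\<sigma> i \<in> \<sigma> ` {i. pos i \<le> k} \<longleftrightarrow> pos i \<le> k" for i
      using assms by (auto simp: bij_def inj_eq)
    then have "y m \<in> cell k \<sigma>" for m
      using x by (auto simp: cell_def y_def coord_subspace_def zero_prod_def)
    moreover have "y \<longlonglongrightarrow> x"
    proof (rule vec_tendstoI)
      fix j
      have "(\<lambda>m. (inverse (real (Suc m)), 0::real)) \<longlonglongrightarrow> (0, 0)"
        by (intro tendsto_Pair LIMSEQ_inverse_real_of_nat tendsto_const)
      moreover have "y m $ j = (inverse (real (Suc m)), 0)" if "j \<in> \<sigma> ` {i. pos i \<le> k}" "x $ j = 0" for m
        using that by (simp add: y_def)
      moreover have "y m $ j = x $ j" if "\<not> (j \<in> \<sigma> ` {i. pos i \<le> k} \<and> x $ j = 0)" for m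
        using that by (auto simp: y_def)
      ultimately show "(\<lambda>m. y m $ j) \<longlonglongrightarrow> x $ j"
        by (cases "j \<in> \<sigma> ` {i. pos i \<le> k} \<and> x $ j = 0") (simp_all add: zero_prod_def)
    qed
    ultimately show "x \<in> closure (cell k \<sigma>)" unfolding closure_sequential by blast
  qed
qed

section \<open>Orbital equivalence by time-preserving conjugacy\<close>

text \<open>
  Maximality is preserved because an extension of the image of a curve is mapped back by \<open>h'\<close> to an
  extension of the curve. The time change is the identity.
\<close>
lemma carries_orbits_if_conjugates:
  assumes hh: "homeomorphism S S h h'"
    and h: "\<And>I \<gamma>. integral_curve S F I \<gamma> \<Longrightarrow> integral_curve S G I (\<lambda>t. h (\<gamma> t))"
    and h': "\<And>I \<gamma>. integral_curve S G I \<gamma> \<Longrightarrow> integral_curve S F I (\<lambda>t. h' (\<gamma> t))"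
  shows "carries_orbits S F G h"
  unfolding carries_orbits_def
proof (intro allI impI)
  fix I \<gamma> assume max: "maximal_integral_curve S F I \<gamma>"
  have "J = I" if J: "integral_curve S G J \<delta>" "I \<subseteq> J" "\<forall>t\<in>I. \<delta> t = h (\<gamma> t)" for J \<delta>
  proof -
    have "\<gamma> t \<in> S" if "t \<in> I" for t
      using that max by (simp add: maximal_integral_curve_def integral_curve_def)
    then have "\<forall>t\<in>I. h' (\<delta> t) = \<gamma> t" using J(3) hh by (simp add: homeomorphism_apply1)
    with h'[OF J(1)] J(2) max show ?thesis unfolding maximal_integral_curve_def by blast
  qed
  with h max have "maximal_integral_curve S G I (\<lambda>t. h (\<gamma> t))"
    unfolding maximal_integral_curve_def by blast
  then show "\<exists>J \<delta> \<tau>. maximal_integral_curve S G J \<delta> \<and> strict_mono_on I \<tau> \<and> \<tau> ` I = J \<and> (\<forall>t\<in>I. h (\<gamma> t) = \<delta> (\<tau> t))"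
    by (intro exI[of _ I] exI[of _ "\<lambda>t. h (\<gamma> t)"] exI[of _ id]) (simp add: strict_mono_on_def)
qed

lemma orbitally_equivalent_if_conjugate:
  assumes "homeomorphism S S h h'"
    and "\<And>I \<gamma>. integral_curve S F I \<gamma> \<Longrightarrow> integral_curve S G I (\<lambda>t. h (\<gamma> t))"
    and "\<And>I \<gamma>. integral_curve S G I \<gamma> \<Longrightarrow> integral_curve S F I (\<lambda>t. h' (\<gamma> t))"
  shows "orbitally_equivalent S F G"
  unfolding orbitally_equivalent_def
  using assms carries_orbits_if_conjugates[of S h h' F G] carries_orbits_if_conjugates[of S h' h G F]
  by (meson homeomorphism_symD)

text \<open>
  Along an orbit with signed amplitude \<open>A \<noteq> 0\<close> the quantity \<open>w = 1 / A\<close> satisfies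
  \<open>w' = -2 (\<nu> w + 1)\<close>, so \<open>\<nu> w + 1\<close> is a constant multiple of \<open>exp (-2 \<nu> t)\<close>. The signed power with
  exponent \<open>\<nu>2 / \<nu>1\<close> turns such a decay for \<open>\<nu>1\<close> into one for \<open>\<nu>2\<close>.
\<close>
definition inverse_amplitude_map :: "real \<Rightarrow> real \<Rightarrow> real \<Rightarrow> real"
  where "inverse_amplitude_map \<nu>1 \<nu>2 w = (signed_powr (\<nu>2 / \<nu>1) (\<nu>1 * w + 1) - 1) / \<nu>2"

text \<open>
  The radial scaling whose effect on \<open>w = 1 / A\<close> is \<^const>\<open>inverse_amplitude_map\<close>.\<close>
definition amplitude_conjugacy ::
    "('n \<Rightarrow> real) \<Rightarrow> real \<Rightarrow> real \<Rightarrow> (real \<times> real) ^ 'n::{finite,linorder} \<Rightarrow> (real \<times> real) ^ 'n::{finite,linorder}"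
  where "amplitude_conjugacy a \<nu>1 \<nu>2 x =
    sqrt (inverse (amplitude a x) / inverse_amplitude_map \<nu>1 \<nu>2 (inverse (amplitude a x))) *\<^sub>R x"

lemma inverse_amplitude_map_inverse:
  assumes "0 < \<nu>1 * \<nu>2"
  shows "inverse_amplitude_map \<nu>2 \<nu>1 (inverse_amplitude_map \<nu>1 \<nu>2 w) = w"
proof -
  have "\<nu>1 \<noteq> 0" "\<nu>2 \<noteq> 0" using assms by auto
  then show ?thesis
    by (simp add: inverse_amplitude_map_def signed_powr_inverse)
qed

text \<open>
  The quotient is positive because the signed power keeps \<open>\<nu>1 w + 1\<close> on its side of 1. This
  makes the square root in the conjugacy meaningful on every orbit, whichever the sign of \<open>A\<close>.
\<close>
lemma inverse_amplitude_map_sign: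
  assumes "0 < \<nu>1 * \<nu>2" "w \<noteq> 0"
  shows "0 < w / inverse_amplitude_map \<nu>1 \<nu>2 w"
proof -
  have p: "0 < \<nu>2 / \<nu>1" using assms by (simp add: zero_less_mult_iff zero_less_divide_iff) argo
  have "0 < \<nu>1 * w \<Longrightarrow> 1 < signed_powr (\<nu>2 / \<nu>1) (\<nu>1 * w + 1)"
       "\<nu>1 * w < 0 \<Longrightarrow> signed_powr (\<nu>2 / \<nu>1) (\<nu>1 * w + 1) < 1"
    using p by (auto intro: signed_powr_gt_one signed_powr_less_one)
  moreover have "0 < \<nu>1 * w \<or> \<nu>1 * w < 0" using assms by (auto simp: linorder_neq_iff[symmetric])
  ultimately have "0 < (\<nu>1 * w) * (signed_powr (\<nu>2 / \<nu>1) (\<nu>1 * w + 1) - 1)"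
    by (smt (verit) mult_pos_pos mult_neg_neg)
  moreover have "(\<nu>1 * w) * (signed_powr (\<nu>2 / \<nu>1) (\<nu>1 * w + 1) - 1) = (\<nu>1 * \<nu>2) * (w * inverse_amplitude_map \<nu>1 \<nu>2 w)"
    using assms by (auto simp: inverse_amplitude_map_def)
  ultimately show ?thesis
    using assms(1) by (simp add: zero_less_mult_iff zero_less_divide_iff)
qed

lemma isCont_inverse_amplitude_map:
  assumes "0 < \<nu>1 * \<nu>2"
  shows "isCont (inverse_amplitude_map \<nu>1 \<nu>2) w"
proof -
  have p: "0 < \<nu>2 / \<nu>1" "\<nu>2 \<noteq> 0" using assms by (auto simp: zero_less_mult_iff zero_less_divide_iff)
  have "isCont (\<lambda>w. signed_powr (\<nu>2 / \<nu>1) (\<nu>1 * w + 1)) w"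
    by (rule isCont_o2[OF _ continuous_signed_powr[OF p(1)]]) (intro continuous_intros)
  then show ?thesis unfolding inverse_amplitude_map_def using p(2) by (intro continuous_intros) auto
qed

lemma inverse_amplitude_map_at_infinity:
  assumes "0 < \<nu>1 * \<nu>2"
  shows "filterlim (inverse_amplitude_map \<nu>1 \<nu>2) at_infinity at_infinity"
proof -
  have p: "0 < \<nu>2 / \<nu>1" "\<nu>1 \<noteq> 0" "\<nu>2 \<noteq> 0" using assms by (auto simp: zero_less_mult_iff zero_less_divide_iff)
  have "filterlim (\<lambda>w. 1 + \<nu>1 * w) at_infinity at_infinity"
    using p(2) by (intro tendsto_add_filterlim_at_infinity tendsto_const
        tendsto_mult_filterlim_at_infinity filterlim_ident) auto
  then have "filterlim (\<lambda>w. signed_powr (\<nu>2 / \<nu>1) (\<nu>1 * w + 1)) at_infinity at_infinity"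
    using filterlim_compose[OF signed_powr_at_infinity[OF p(1)]] by (simp add: add.commute)
  then have "filterlim (\<lambda>w. inverse \<nu>2 * (- 1 + signed_powr (\<nu>2 / \<nu>1) (\<nu>1 * w + 1))) at_infinity at_infinity"
    using p(3) by (intro tendsto_mult_filterlim_at_infinity[OF tendsto_const]
        tendsto_add_filterlim_at_infinity[OF tendsto_const]) auto
  then show ?thesis unfolding inverse_amplitude_map_def by (simp add: field_simps)
qed

lemma amplitude_conjugacy_zero [simp]: "amplitude_conjugacy a \<nu>1 \<nu>2 0 = 0"
  by (simp add: amplitude_conjugacy_def)

lemma inverse_amplitude_map_nonzero:
  assumes "0 < \<nu>1 * \<nu>2" "w \<noteq> 0"
  shows "inverse_amplitude_map \<nu>1 \<nu>2 w \<noteq> 0"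
  using inverse_amplitude_map_sign[OF assms] by auto

lemma amplitude_of_conjugacy:
  assumes "0 < \<nu>1 * \<nu>2" "amplitude a x \<noteq> 0"
  shows "amplitude a (amplitude_conjugacy a \<nu>1 \<nu>2 x) =
    inverse (inverse_amplitude_map \<nu>1 \<nu>2 (inverse (amplitude a x)))"
proof -
  define w where "w = inverse (amplitude a x)"
  have A: "amplitude a x = inverse w" "w \<noteq> 0" using assms(2) by (simp_all add: w_def)
  show ?thesis
    using inverse_amplitude_map_sign[OF assms(1) A(2)] A(2)
    by (simp add: amplitude_conjugacy_def amplitude_scaleR A(1) less_imp_le field_simps)
qed

lemma integral_curve_amplitude:
  assumes "integral_curve S (normal_form \<omega> a \<nu>) I \<gamma>" "t \<in> I"
  shows "((\<lambda>t. amplitude a (\<gamma> t)) has_real_derivative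
           2 * (\<nu> + amplitude a (\<gamma> t)) * amplitude a (\<gamma> t)) (at t)"
  using assms by (intro has_real_derivative_amplitude[where \<omega> = \<omega>]) (simp add: integral_curve_def)

lemma integral_curve_continuous:
  assumes "integral_curve S F I \<gamma>"
  shows "continuous_on I \<gamma>"
  using assms by (auto simp: integral_curve_def
      intro!: continuous_at_imp_continuous_on has_vector_derivative_continuous)

lemma continuous_amplitude_curve:
  assumes "integral_curve S F I \<gamma>"
  shows "continuous_on I (\<lambda>t. amplitude a (\<gamma> t))"
  using continuous_on_compose2[OF continuous_on_amplitude[of UNIV] integral_curve_continuous[OF assms]] by simp

text \<open>
  Both \<open>A\<close> and \<open>\<nu> + A\<close> solve linear homogeneous equations along an orbit, with coefficients
  \<open>2 (\<nu> + A)\<close> and \<open>2 A\<close>. Hence the levels \<open>A = 0\<close> and \<open>A = -\<nu>\<close> are never entered or left.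
\<close>
lemma amplitude_zero_invariant:
  assumes \<gamma>: "integral_curve S (normal_form \<omega> a \<nu>) I \<gamma>"
    and t: "t0 \<in> I" "t1 \<in> I" and zero: "amplitude a (\<gamma> t0) = 0"
  shows "amplitude a (\<gamma> t1) = 0"
proof (rule linear_ode_zero[where f = "\<lambda>t. amplitude a (\<gamma> t)" and b = "\<lambda>t. 2 * (\<nu> + amplitude a (\<gamma> t))"])
  show "is_interval I" using \<gamma> by (simp add: integral_curve_def)
  show "continuous_on I (\<lambda>t. 2 * (\<nu> + amplitude a (\<gamma> t)))"
    by (intro continuous_intros continuous_amplitude_curve[OF \<gamma>])
qed (use t zero integral_curve_amplitude[OF \<gamma>] in auto)

lemma amplitude_equilibrium_invariant:
  assumes \<gamma>: "integral_curve S (normal_form \<omega> a \<nu>) I \<gamma>"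
    and t: "t0 \<in> I" "t1 \<in> I" and eq: "amplitude a (\<gamma> t0) = - \<nu>"
  shows "amplitude a (\<gamma> t1) = - \<nu>"
proof -
  have "\<nu> + amplitude a (\<gamma> t1) = 0"
  proof (rule linear_ode_zero[where f = "\<lambda>t. \<nu> + amplitude a (\<gamma> t)" and b = "\<lambda>t. 2 * amplitude a (\<gamma> t)"])
    show "is_interval I" using \<gamma> by (simp add: integral_curve_def)
    show "continuous_on I (\<lambda>t. 2 * amplitude a (\<gamma> t))"
      by (intro continuous_intros continuous_amplitude_curve[OF \<gamma>])
    show "((\<lambda>t. \<nu> + amplitude a (\<gamma> t)) has_real_derivative
        2 * amplitude a (\<gamma> t) * (\<nu> + amplitude a (\<gamma> t))) (at t)" if "t \<in> I" for t
      by (auto intro!: derivative_eq_intros integral_curve_amplitude[OF \<gamma> that])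
  qed (use t eq in auto)
  then show ?thesis by simp
qed

text \<open>
  Solving the equation for \<open>w = 1 / A\<close> in closed form makes its image under
  \<^const>\<open>inverse_amplitude_map\<close> an explicit exponential, hence differentiable, even on the orbits
  with \<open>\<nu>1 w + 1 = 0\<close>, at which the signed power itself need not be.
\<close>
lemma inverse_amplitude_map_curve:
  assumes \<gamma>: "integral_curve S (normal_form \<omega> a \<nu>1) I \<gamma>"
    and \<nu>: "0 < \<nu>1 * \<nu>2"
    and nz: "\<And>t. t \<in> I \<Longrightarrow> amplitude a (\<gamma> t) \<noteq> 0"
    and t: "t \<in> I"
  defines "W \<equiv> \<lambda>t. inverse_amplitude_map \<nu>1 \<nu>2 (inverse (amplitude a (\<gamma> t)))"
  shows "(W has_real_derivative - 2 * (\<nu>2 * W t + 1)) (at t)"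
proof -
  have \<nu>0: "\<nu>1 \<noteq> 0" "\<nu>2 \<noteq> 0" using \<nu> by auto
  have I: "open I" "is_interval I" using \<gamma> by (auto simp: integral_curve_def)
  define u where "u t = \<nu>1 * inverse (amplitude a (\<gamma> t)) + 1" for t
  have "((\<lambda>t. u t * exp (2 * \<nu>1 * t)) has_real_derivative 0) (at t within I)" if "t \<in> I" for t
    unfolding u_def
    by (rule has_field_derivative_at_within)
      (use nz[OF that] in \<open>auto intro!: derivative_eq_intros integral_curve_amplitude[OF \<gamma> that] simp: field_simps power2_eq_square\<close>)
  then obtain C where C: "\<forall>t\<in>I. u t * exp (2 * \<nu>1 * t) = C"
    using has_field_derivative_zero_constant[of I "\<lambda>t. u t * exp (2 * \<nu>1 * t)"] I(2)
    by (auto simp: is_interval_convex_1)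
  define K where "K = signed_powr (\<nu>2 / \<nu>1) C"
  have W: "W s = (K * exp (- 2 * \<nu>2 * s) - 1) / \<nu>2" if "s \<in> I" for s
  proof -
    have "u s = C * exp (- 2 * \<nu>1 * s)"
      using C that by (auto simp: mult.assoc simp flip: exp_add)
    then have "signed_powr (\<nu>2 / \<nu>1) (u s) = K * exp (- 2 * \<nu>1 * s) powr (\<nu>2 / \<nu>1)"
      unfolding K_def by (simp only: signed_powr_mult_pos exp_gt_zero)
    also have "exp (- 2 * \<nu>1 * s) powr (\<nu>2 / \<nu>1) = exp (- 2 * \<nu>2 * s)"
      using \<nu>0 by (simp add: exp_powr_real)
    finally show ?thesis by (simp add: W_def inverse_amplitude_map_def u_def)
  qed
  have "((\<lambda>t. (K * exp (- 2 * \<nu>2 * t) - 1) / \<nu>2) has_real_derivative - 2 * (\<nu>2 * W t + 1)) (at t)"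
    using \<nu>0 by (auto intro!: derivative_eq_intros simp: W[OF t])
  then show ?thesis
    by (rule has_field_derivative_transform_within_open[OF _ I(1) t]) (simp add: W)
qed

text \<open>
  With \<open>m = sqrt (w / W)\<close>, where \<open>W\<close> is the image of \<open>w\<close>, the equations for \<open>w\<close> and \<open>W\<close> give
  \<open>m' = m ((\<nu>2 + 1 / W) - (\<nu>1 + 1 / w))\<close>. This is exactly the correction that turns the
  radial rate \<open>\<nu>1 + A\<close> of \<open>\<gamma>\<close> into the rate \<open>\<nu>2 + 1 / W\<close> required of \<open>m \<gamma>\<close>, whose signed amplitude
  is \<open>1 / W\<close>.
\<close>
lemma integral_curve_conjugacy:
  assumes \<gamma>: "integral_curve S (normal_form \<omega> a \<nu>1) I \<gamma>"
    and \<nu>: "0 < \<nu>1 * \<nu>2"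
    and S: "\<And>c x. x \<in> S \<Longrightarrow> c *\<^sub>R x \<in> S"
    and definite: "\<And>x. x \<in> S \<Longrightarrow> amplitude a x = 0 \<Longrightarrow> x = 0"
  shows "integral_curve S (normal_form \<omega> a \<nu>2) I (\<lambda>t. amplitude_conjugacy a \<nu>1 \<nu>2 (\<gamma> t))"
proof -
  have I: "open I" "is_interval I" "I \<noteq> {}" using \<gamma> by (auto simp: integral_curve_def)
  have inS: "\<gamma> t \<in> S" if "t \<in> I" for t using \<gamma> that by (auto simp: integral_curve_def)
  have "((\<lambda>t. amplitude_conjugacy a \<nu>1 \<nu>2 (\<gamma> t)) has_vector_derivative
      normal_form \<omega> a \<nu>2 (amplitude_conjugacy a \<nu>1 \<nu>2 (\<gamma> t))) (at t)" if t: "t \<in> I" for t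
  proof (cases "\<exists>t0\<in>I. amplitude a (\<gamma> t0) = 0")
    case True
    then have "\<gamma> s = 0" if "s \<in> I" for s
      using amplitude_zero_invariant[OF \<gamma> _ that] definite inS[OF that] by blast
    then have zero: "amplitude_conjugacy a \<nu>1 \<nu>2 (\<gamma> s) = 0" if "s \<in> I" for s
      using that by simp
    have "((\<lambda>_. 0) has_vector_derivative normal_form \<omega> a \<nu>2 (amplitude_conjugacy a \<nu>1 \<nu>2 (\<gamma> t))) (at t)"
      by (simp add: zero[OF t] normal_form_zero)
    then show ?thesis
      by (rule has_vector_derivative_transform_within_open[OF _ I(1) t]) (simp add: zero)
  next
    case False
    then have nz: "amplitude a (\<gamma> s) \<noteq> 0" if "s \<in> I" for s using that by blast
    define w where "w s = inverse (amplitude a (\<gamma> s))" for s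
    define W where "W s = inverse_amplitude_map \<nu>1 \<nu>2 (w s)" for s
    define m where "m s = sqrt (w s / W s)" for s
    have w0: "w t \<noteq> 0" using nz[OF t] by (simp add: w_def)
    have pos: "0 < w t / W t" unfolding W_def by (rule inverse_amplitude_map_sign[OF \<nu> w0])
    have W0: "W t \<noteq> 0" using pos by auto
    have dw: "(w has_real_derivative - 2 * (\<nu>1 * w t + 1)) (at t)"
      unfolding w_def using nz[OF t]
      by (auto intro!: derivative_eq_intros integral_curve_amplitude[OF \<gamma> t] simp: field_simps power2_eq_square)
    have dW: "(W has_real_derivative - 2 * (\<nu>2 * W t + 1)) (at t)"
      unfolding W_def w_def by (rule inverse_amplitude_map_curve[OF \<gamma> \<nu> nz t])
    define D where "D = ((- 2 * (\<nu>1 * w t + 1)) * W t - w t * (- 2 * (\<nu>2 * W t + 1))) / (W t * W t)"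
    have "((\<lambda>s. w s / W s) has_real_derivative D) (at t)"
      unfolding D_def by (rule DERIV_divide[OF dw dW W0])
    moreover have "D = 2 * (w t / W t) * ((\<nu>2 + inverse (W t)) - (\<nu>1 + inverse (w t)))"
    proof -
      have "((- 2 * (v1 * p + 1)) * q - p * (- 2 * (v2 * q + 1))) / (q * q) =
          2 * (p / q) * ((v2 + inverse q) - (v1 + inverse p))"
        if "p \<noteq> 0" "q \<noteq> 0" for p q v1 v2 :: real
        using that by (simp add: divide_simps) algebra
      then show ?thesis unfolding D_def using w0 W0 by blast
    qed
    ultimately have dq: "((\<lambda>s. w s / W s) has_real_derivative
        2 * (w t / W t) * ((\<nu>2 + inverse (W t)) - (\<nu>1 + inverse (w t)))) (at t)"
      by simp
    have m2: "w t / W t = m t * m t" by (simp only: m_def real_sqrt_mult_self abs_of_pos[OF pos])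
    have m0: "m t \<noteq> 0" using m2 pos by force
    have "(m has_real_derivative inverse (m t) / 2 *
        (2 * (w t / W t) * ((\<nu>2 + inverse (W t)) - (\<nu>1 + inverse (w t))))) (at t)"
      unfolding m_def by (rule DERIV_chain2[OF DERIV_real_sqrt[OF pos] dq])
    moreover have "inverse (m t) / 2 * (2 * (m t * m t) * X) = m t * X" for X
      using m0 by (simp add: divide_simps)
    ultimately have dm: "(m has_real_derivative m t * ((\<nu>2 + inverse (W t)) - (\<nu>1 + inverse (w t)))) (at t)"
      unfolding m2 by metis
    have d\<gamma>: "(\<gamma> has_vector_derivative Theta \<omega> (\<gamma> t) + (\<nu>1 + inverse (w t)) *\<^sub>R \<gamma> t) (at t)"
      using \<gamma> t by (simp add: integral_curve_def normal_form_eq w_def)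
    have conj: "amplitude_conjugacy a \<nu>1 \<nu>2 (\<gamma> s) = m s *\<^sub>R \<gamma> s" for s
      by (simp add: amplitude_conjugacy_def m_def W_def w_def)
    have "amplitude a (m t *\<^sub>R \<gamma> t) = inverse (W t)"
      using amplitude_of_conjugacy[OF \<nu> nz[OF t]] by (simp add: conj W_def w_def)
    then have "normal_form \<omega> a \<nu>2 (m t *\<^sub>R \<gamma> t) =
        m t *\<^sub>R (Theta \<omega> (\<gamma> t) + (\<nu>1 + inverse (w t)) *\<^sub>R \<gamma> t) +
        (m t * ((\<nu>2 + inverse (W t)) - (\<nu>1 + inverse (w t)))) *\<^sub>R \<gamma> t"
      by (simp add: normal_form_eq Theta_scaleR algebra_simps)
    then show ?thesis
      unfolding conj using has_vector_derivative_scaleR[OF dm d\<gamma>] by simp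
  qed
  moreover have "amplitude_conjugacy a \<nu>1 \<nu>2 (\<gamma> t) \<in> S" if "t \<in> I" for t
    using S[OF inS[OF that]] by (simp add: amplitude_conjugacy_def)
  ultimately show ?thesis using I by (simp add: integral_curve_def)
qed

section \<open>Blow-up at the bifurcation value\<close>

text \<open>
  The solution of \<open>A' = 2 A\<^sup>2\<close> is \<open>A 0 / (1 - 2 A 0 t)\<close>; the corresponding orbit is scaled by
  the square root and rotated.
\<close>
definition blow_up_curve ::
    "('n \<Rightarrow> real) \<Rightarrow> ('n \<Rightarrow> real) \<Rightarrow> (real \<times> real) ^ 'n::{finite,linorder} \<Rightarrow> real \<Rightarrow> (real \<times> real) ^ 'n::{finite,linorder}"
  where "blow_up_curve \<omega> a x t = inverse (sqrt (1 - 2 * amplitude a x * t)) *\<^sub>R rotation \<omega> t x"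

lemma amplitude_blow_up_curve:
  assumes "0 < 1 - 2 * amplitude a x * t"
  shows "(1 - 2 * amplitude a x * t) * amplitude a (blow_up_curve \<omega> a x t) = amplitude a x"
proof -
  have "q * ((inverse (sqrt q))\<^sup>2 * A) = A" if "0 < q" for q A :: real
    using that by (simp add: field_simps)
  from this[OF assms] show ?thesis
    by (simp add: blow_up_curve_def amplitude_scaleR amplitude_rotation)
qed

text \<open>
  The half-line of existence cannot be extended: \<open>(1 - 2 A 0 t) A t\<close> is constantly \<open>A 0 \<noteq> 0\<close> on
  it, but by continuity would have to vanish at the blow-up time.
\<close>
lemma maximal_blow_up_curve:
  assumes S: "\<And>c x. x \<in> S \<Longrightarrow> c *\<^sub>R x \<in> S" "\<And>t x. x \<in> S \<Longrightarrow> rotation \<omega> t x \<in> S"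
    and x: "x \<in> S" "amplitude a x \<noteq> 0"
  shows "maximal_integral_curve S (normal_form \<omega> a 0) {t. 0 < 1 - 2 * amplitude a x * t} (blow_up_curve \<omega> a x)"
proof -
  define A where "A = amplitude a x"
  define I where "I = {t. 0 < 1 - 2 * A * t}"
  define \<gamma> where "\<gamma> = blow_up_curve \<omega> a x"
  have A0: "A \<noteq> 0" using x by (simp add: A_def)
  have I0: "0 \<in> I" by (simp add: I_def)
  have amp: "(1 - 2 * A * t) * amplitude a (\<gamma> t) = A" if "t \<in> I" for t
    using amplitude_blow_up_curve[of a x t \<omega>] that by (simp add: I_def A_def \<gamma>_def)
  have I: "open I" "is_interval I"
  proof -
    show "open I" unfolding I_def by (intro open_Collect_less continuous_intros)
    have "I = {t. inner (2 * A) t < 1}" by (auto simp: I_def)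
    then show "is_interval I" by (simp only: is_interval_convex_1 convex_halfspace_lt)
  qed
  have deriv: "(\<gamma> has_vector_derivative normal_form \<omega> a 0 (\<gamma> t)) (at t)" if t: "t \<in> I" for t
  proof -
    define q where "q = 1 - 2 * A * t"
    have q: "0 < q" using t by (simp add: q_def I_def)
    have m: "((\<lambda>t. inverse (sqrt (1 - 2 * A * t))) has_real_derivative inverse (sqrt q) * (A / q)) (at t)"
    proof -
      have ds: "((\<lambda>t. sqrt (1 - 2 * A * t)) has_real_derivative inverse (sqrt q) / 2 * (- 2 * A)) (at t)"
        unfolding q_def
        by (rule DERIV_chain2[where g = "\<lambda>t. 1 - 2 * A * t", OF DERIV_real_sqrt[OF q[unfolded q_def]]])
          (auto intro!: derivative_eq_intros)
      have "((\<lambda>t. inverse (sqrt (1 - 2 * A * t))) has_real_derivative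
          - (inverse (sqrt q) * (inverse (sqrt q) / 2 * (- 2 * A)) * inverse (sqrt q))) (at t)"
        using DERIV_inverse'[OF ds] q unfolding q_def by (metis less_irrefl real_sqrt_gt_zero)
      moreover have "inverse (sqrt q) * inverse (sqrt q) = inverse q"
        using q by (simp flip: inverse_mult_distrib)
      then have "- (inverse (sqrt q) * (inverse (sqrt q) / 2 * (- 2 * A)) * inverse (sqrt q)) = inverse (sqrt q) * (A / q)"
      proof -
        have "- (p * (p / 2 * (- 2 * A)) * p) = p * (A * r)" if "p * p = r" for p r :: real
          using that by auto
        then show ?thesis
          using \<open>inverse (sqrt q) * inverse (sqrt q) = inverse q\<close> by (simp only: divide_inverse)
      qed
      ultimately show ?thesis by simp
    qed
    have "amplitude a (\<gamma> t) = A / q" using amp[OF t] q by (simp add: q_def field_simps)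
    then have nf: "normal_form \<omega> a 0 (\<gamma> t) = Theta \<omega> (\<gamma> t) + (A / q) *\<^sub>R \<gamma> t"
      by (simp add: normal_form_eq)
    have \<gamma>_eq: "\<gamma> = (\<lambda>t. inverse (sqrt (1 - 2 * A * t)) *\<^sub>R rotation \<omega> t x)"
      by (simp add: \<gamma>_def blow_up_curve_def A_def fun_eq_iff)
    have "\<gamma> t = inverse (sqrt q) *\<^sub>R rotation \<omega> t x" by (simp add: \<gamma>_eq q_def)
    then have "normal_form \<omega> a 0 (\<gamma> t) = inverse (sqrt q) *\<^sub>R Theta \<omega> (rotation \<omega> t x) +
        (inverse (sqrt q) * (A / q)) *\<^sub>R rotation \<omega> t x"
      unfolding nf by (simp add: Theta_scaleR mult.commute)
    moreover have "(\<gamma> has_vector_derivative inverse (sqrt q) *\<^sub>R Theta \<omega> (rotation \<omega> t x) +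
        (inverse (sqrt q) * (A / q)) *\<^sub>R rotation \<omega> t x) (at t)"
      unfolding \<gamma>_eq using has_vector_derivative_scaleR[OF m has_vector_derivative_rotation[of \<omega> x t]]
      by (simp add: q_def)
    ultimately show ?thesis by simp
  qed
  have "integral_curve S (normal_form \<omega> a 0) I \<gamma>"
    using I I0 S x deriv by (auto simp: integral_curve_def \<gamma>_def blow_up_curve_def)
  moreover have "J = I" if J: "integral_curve S (normal_form \<omega> a 0) J \<delta>" "I \<subseteq> J" "\<forall>t\<in>I. \<delta> t = \<gamma> t" for J \<delta>
  proof (rule ccontr)
    assume "J \<noteq> I"
    then obtain t1 where t1: "t1 \<in> J" "1 \<le> 2 * A * t1" using J(2) by (force simp: I_def)
    \<comment> \<open>the blow-up time, which separates \<open>0\<close> from \<open>t1\<close>\<close>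
    define T where "T = 1 / (2 * A)"
    have JJ: "open J" "is_interval J" using J(1) by (auto simp: integral_curve_def)
    have "T \<in> closed_segment 0 t1"
    proof -
      have "0 < A * t1" using t1(2) by simp
      then have "0 < A \<and> 0 < t1 \<or> A < 0 \<and> t1 < 0" by (simp add: zero_less_mult_iff)
      then show ?thesis using t1(2) by (auto simp: T_def closed_segment_eq_real_ivl field_simps)
    qed
    moreover have "closed_segment 0 t1 \<subseteq> J"
      using JJ(2) t1(1) I0 J(2) by (intro closed_segment_subset) (auto simp: is_interval_convex_1)
    ultimately have TJ: "T \<in> J" by blast
    define f where "f t = (1 - 2 * A * t) * amplitude a (\<delta> t)" for t
    have "continuous_on J f"
      unfolding f_def by (intro continuous_intros continuous_amplitude_curve[OF J(1)])
    then have "isCont f T" using JJ(1) TJ by (simp add: continuous_on_eq_continuous_at)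
    define r where "r m = T * (1 - inverse (real (Suc m)))" for m
    have "r \<longlonglongrightarrow> T * (1 - 0)"
      unfolding r_def by (intro tendsto_intros LIMSEQ_inverse_real_of_nat)
    then have "(\<lambda>m. f (r m)) \<longlonglongrightarrow> f T"
      using \<open>isCont f T\<close> by (simp add: isCont_tendsto_compose)
    moreover have "f (r m) = A" for m
    proof -
      have "2 * A * r m = (2 * A * T) * (1 - inverse (real (Suc m)))" by (simp only: r_def mult.assoc)
      then have "1 - 2 * A * r m = inverse (real (Suc m))" using A0 by (simp add: T_def)
      moreover have "0 < inverse (real (Suc m))" by simp
      ultimately have "r m \<in> I" unfolding I_def by (simp only: mem_Collect_eq)
      then show ?thesis using amp J(3) by (simp add: f_def)
    qed
    ultimately have "f T = A" by (simp add: LIMSEQ_const_iff)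
    moreover have "f T = 0" using A0 by (simp add: f_def T_def)
    ultimately show False using A0 by simp
  qed
  ultimately show ?thesis
    unfolding maximal_integral_curve_def A_def I_def \<gamma>_def by blast
qed

section \<open>Definite amplitudes\<close>

locale definite_amplitude =
  fixes a :: "'n::{finite,linorder} \<Rightarrow> real" and L :: "'n set"
  assumes same_sign: "i \<in> L \<Longrightarrow> j \<in> L \<Longrightarrow> 0 < a i * a j"
begin

text \<open>
  The constant is the least \<open>\<bar>a j\<bar>\<close> with \<open>j \<in> L\<close>, capped at 1 so that it exists for empty \<open>L\<close>.
\<close>
lemma amplitude_lower_bound:
  obtains c where "0 < c" "\<And>x. x \<in> coord_subspace L \<Longrightarrow> c * (norm x)\<^sup>2 \<le> \<bar>amplitude a x\<bar>"
proof
  define c where "c = Min (insert 1 ((\<lambda>j. \<bar>a j\<bar>) ` L))"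
  have nz: "a j \<noteq> 0" if "j \<in> L" for j using same_sign[OF that that] by auto
  then show "0 < c" by (auto simp: c_def)
  fix x assume x: "x \<in> coord_subspace L"
  have "c * (norm x)\<^sup>2 = (\<Sum>j\<in>UNIV. c * (norm (x $ j))\<^sup>2)"
    by (simp add: norm_vec_def L2_set_def sum_nonneg sum_distrib_left)
  also have "\<dots> \<le> (\<Sum>j\<in>UNIV. \<bar>a j\<bar> * (norm (x $ j))\<^sup>2)"
  proof (rule sum_mono)
    fix j
    show "c * (norm (x $ j))\<^sup>2 \<le> \<bar>a j\<bar> * (norm (x $ j))\<^sup>2"
      using x by (cases "j \<in> L") (auto simp: c_def coord_subspace_def intro!: mult_right_mono)
  qed
  also have "\<dots> \<le> \<bar>amplitude a x\<bar>"
  proof -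
    have "\<exists>s. \<bar>s\<bar> \<le> 1 \<and> (\<forall>j\<in>L. \<bar>a j\<bar> = s * a j)"
    proof (cases "L = {}")
      case False
      then obtain i where "i \<in> L" by blast
      have "\<bar>a j\<bar> = sgn (a i) * a j" if "j \<in> L" for j
        using same_sign[OF \<open>i \<in> L\<close> that] by (auto simp: zero_less_mult_iff)
      then show ?thesis by (intro exI[of _ "sgn (a i)"]) (auto simp: sgn_if)
    qed (auto intro: exI[of _ 0])
    then obtain s where s: "\<bar>s\<bar> \<le> 1" "\<forall>j\<in>L. \<bar>a j\<bar> = s * a j" by blast
    have "(\<Sum>j\<in>UNIV. \<bar>a j\<bar> * (norm (x $ j))\<^sup>2) = (\<Sum>j\<in>UNIV. s * (a j * (norm (x $ j))\<^sup>2))"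
    proof (rule sum.cong[OF refl])
      fix j
      show "\<bar>a j\<bar> * (norm (x $ j))\<^sup>2 = s * (a j * (norm (x $ j))\<^sup>2)"
        using x s(2) by (cases "j \<in> L") (auto simp: coord_subspace_def)
    qed
    also have "\<dots> = s * amplitude a x" by (simp add: amplitude_def sum_distrib_left)
    also have "\<dots> \<le> \<bar>s\<bar> * \<bar>amplitude a x\<bar>" by (simp flip: abs_mult)
    also have "\<dots> \<le> \<bar>amplitude a x\<bar>" using mult_right_mono[OF s(1), of "\<bar>amplitude a x\<bar>"] by simp
    finally show ?thesis .
  qed
  finally show "c * (norm x)\<^sup>2 \<le> \<bar>amplitude a x\<bar>" .
qed

lemma amplitude_definite:
  assumes "x \<in> coord_subspace L" "amplitude a x = 0"
  shows "x = 0"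
proof -
  obtain c where "0 < c" "\<And>x. x \<in> coord_subspace L \<Longrightarrow> c * (norm x)\<^sup>2 \<le> \<bar>amplitude a x\<bar>"
    using amplitude_lower_bound by blast
  from this(1) this(2)[OF assms(1)] assms(2) show ?thesis
    by (simp add: mult_le_0_iff)
qed

lemma compact_amplitude_level: "compact {x \<in> coord_subspace L. amplitude a x = r}"
proof -
  obtain c where c: "0 < c" "\<And>x. x \<in> coord_subspace L \<Longrightarrow> c * (norm x)\<^sup>2 \<le> \<bar>amplitude a x\<bar>"
    using amplitude_lower_bound by blast
  have "norm x \<le> sqrt (\<bar>r\<bar> / c)" if "x \<in> coord_subspace L" "amplitude a x = r" for x
    using c(1) c(2)[OF that(1)] that(2) by (intro real_le_rsqrt) (simp add: field_simps)
  then have "bounded {x \<in> coord_subspace L. amplitude a x = r}"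
    by (auto simp: bounded_iff)
  moreover have "closed {x. amplitude a x = r}"
    by (intro closed_Collect_eq continuous_on_amplitude continuous_on_const)
  then have "closed (coord_subspace L \<inter> {x. amplitude a x = r})"
    by (intro closed_Int closed_coord_subspace)
  ultimately show ?thesis by (simp add: compact_eq_bounded_closed Int_def)
qed

text \<open>
  Away from the origin all ingredients are continuous. The scaling factor may be unbounded near the
  origin, so continuity there is seen on the images: as \<open>A x \<rightarrow> 0\<close>, \<open>w\<close> and with it its image
  tend to infinity, so the signed amplitude of the image point tends to 0, and by definiteness
  so does the image point.
\<close>
lemma continuous_amplitude_conjugacy:
  assumes \<nu>: "0 < \<nu>1 * \<nu>2"
  shows "continuous_on (coord_subspace L) (amplitude_conjugacy a \<nu>1 \<nu>2)"
  unfolding continuous_on_def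
proof
  fix x assume x: "x \<in> coord_subspace L"
  let ?F = "at x within coord_subspace L"
  have A: "(amplitude a \<longlongrightarrow> amplitude a x) ?F"
    using continuous_on_amplitude[of "coord_subspace L" a] x by (simp add: continuous_on_def)
  show "(amplitude_conjugacy a \<nu>1 \<nu>2 \<longlongrightarrow> amplitude_conjugacy a \<nu>1 \<nu>2 x) ?F"
  proof (cases "x = 0")
    case False
    then have nz: "amplitude a x \<noteq> 0" using amplitude_definite x by blast
    then show ?thesis
      unfolding amplitude_conjugacy_def
      by (intro tendsto_intros A isCont_tendsto_compose[OF isCont_inverse_amplitude_map[OF \<nu>]]
          inverse_amplitude_map_nonzero[OF \<nu>]) auto
  next
    case True
    obtain c where c: "0 < c" "\<And>x. x \<in> coord_subspace L \<Longrightarrow> c * (norm x)\<^sup>2 \<le> \<bar>amplitude a x\<bar>"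
      using amplitude_lower_bound by blast
    have in_F: "\<forall>\<^sub>F y in ?F. y \<in> coord_subspace L \<and> y \<noteq> x"
      by (simp add: eventually_at_filter)
    have "\<forall>\<^sub>F y in ?F. amplitude a y \<noteq> 0"
      using in_F by eventually_elim (use True amplitude_definite in blast)
    then have "filterlim (amplitude a) (at 0) ?F"
      using A True by (simp add: filterlim_at)
    then have "filterlim (\<lambda>y. inverse_amplitude_map \<nu>1 \<nu>2 (inverse (amplitude a y))) at_infinity ?F"
      by (intro filterlim_compose[OF inverse_amplitude_map_at_infinity[OF \<nu>]]
          filterlim_compose[OF filterlim_inverse_at_infinity])
    then have "((\<lambda>y. inverse (inverse_amplitude_map \<nu>1 \<nu>2 (inverse (amplitude a y)))) \<longlongrightarrow> 0) ?F"
      by (rule filterlim_compose[OF tendsto_inverse_0])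
    then have lim: "((\<lambda>y. sqrt (\<bar>inverse (inverse_amplitude_map \<nu>1 \<nu>2 (inverse (amplitude a y)))\<bar> / c)) \<longlongrightarrow> sqrt (\<bar>0\<bar> / c)) ?F"
      using c(1) by (intro tendsto_intros) auto
    have "((\<lambda>y. amplitude_conjugacy a \<nu>1 \<nu>2 y) \<longlongrightarrow> 0) ?F"
    proof (rule Lim_null_comparison)
      show "\<forall>\<^sub>F y in ?F. norm (amplitude_conjugacy a \<nu>1 \<nu>2 y) \<le>
          sqrt (\<bar>inverse (inverse_amplitude_map \<nu>1 \<nu>2 (inverse (amplitude a y)))\<bar> / c)"
        using in_F
      proof eventually_elim
        case (elim y)
        then have nz: "amplitude a y \<noteq> 0" using True amplitude_definite by blast
        have "amplitude_conjugacy a \<nu>1 \<nu>2 y \<in> coord_subspace L"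
          using elim by (simp add: amplitude_conjugacy_def scaleR_coord_subspace)
        from c(2)[OF this] show ?case
          using c(1) by (intro real_le_rsqrt)
            (simp add: amplitude_of_conjugacy[OF \<nu> nz] pos_le_divide_eq mult.commute)
      qed
    qed (use lim in simp)
    then show ?thesis by (simp add: True)
  qed
qed

lemma amplitude_conjugacy_inverse:
  assumes \<nu>: "0 < \<nu>1 * \<nu>2" and x: "x \<in> coord_subspace L"
  shows "amplitude_conjugacy a \<nu>2 \<nu>1 (amplitude_conjugacy a \<nu>1 \<nu>2 x) = x"
proof (cases "x = 0")
  case False
  define w where "w = inverse (amplitude a x)"
  define W where "W = inverse_amplitude_map \<nu>1 \<nu>2 w"
  have nz: "amplitude a x \<noteq> 0" using amplitude_definite x False by blast
  then have w0: "w \<noteq> 0" by (simp add: w_def)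
  have W0: "W \<noteq> 0" unfolding W_def by (rule inverse_amplitude_map_nonzero[OF \<nu> w0])
  have "inverse (amplitude a (amplitude_conjugacy a \<nu>1 \<nu>2 x)) = W"
    using amplitude_of_conjugacy[OF \<nu> nz] by (simp add: W_def w_def)
  moreover have "inverse_amplitude_map \<nu>2 \<nu>1 W = w"
    unfolding W_def by (rule inverse_amplitude_map_inverse[OF \<nu>])
  ultimately have "amplitude_conjugacy a \<nu>2 \<nu>1 (amplitude_conjugacy a \<nu>1 \<nu>2 x) =
      sqrt (W / w) *\<^sub>R amplitude_conjugacy a \<nu>1 \<nu>2 x"
    by (simp add: amplitude_conjugacy_def[of a \<nu>2 \<nu>1])
  also have "\<dots> = (sqrt (W / w) * sqrt (w / W)) *\<^sub>R x"
    by (simp add: amplitude_conjugacy_def w_def W_def)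
  also have "sqrt (W / w) * sqrt (w / W) = 1"
    using w0 W0 by (simp flip: real_sqrt_mult)
  finally show ?thesis by simp
qed simp

lemma orbitally_equivalent_same_sign:
  assumes \<nu>: "0 < \<nu>1 * \<nu>2"
  shows "orbitally_equivalent (coord_subspace L) (normal_form \<omega> a \<nu>1) (normal_form \<omega> a \<nu>2)"
proof (rule orbitally_equivalent_if_conjugate)
  have \<nu>': "0 < \<nu>2 * \<nu>1" using \<nu> by (simp add: mult.commute)
  have into: "amplitude_conjugacy a \<mu>1 \<mu>2 x \<in> coord_subspace L" if "x \<in> coord_subspace L" for \<mu>1 \<mu>2 x
    using that by (simp add: amplitude_conjugacy_def scaleR_coord_subspace)
  show "homeomorphism (coord_subspace L) (coord_subspace L)
      (amplitude_conjugacy a \<nu>1 \<nu>2) (amplitude_conjugacy a \<nu>2 \<nu>1)"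
    using continuous_amplitude_conjugacy[OF \<nu>] continuous_amplitude_conjugacy[OF \<nu>']
      amplitude_conjugacy_inverse[OF \<nu>] amplitude_conjugacy_inverse[OF \<nu>'] into
    by (intro homeomorphismI) auto
  show "integral_curve (coord_subspace L) (normal_form \<omega> a \<nu>2) I (\<lambda>t. amplitude_conjugacy a \<nu>1 \<nu>2 (\<gamma> t))"
    if "integral_curve (coord_subspace L) (normal_form \<omega> a \<nu>1) I \<gamma>" for I \<gamma>
    using that \<nu> scaleR_coord_subspace amplitude_definite by (rule integral_curve_conjugacy)
  show "integral_curve (coord_subspace L) (normal_form \<omega> a \<nu>1) I (\<lambda>t. amplitude_conjugacy a \<nu>2 \<nu>1 (\<gamma> t))"
    if "integral_curve (coord_subspace L) (normal_form \<omega> a \<nu>2) I \<gamma>" for I \<gamma>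
    using that \<nu>' scaleR_coord_subspace amplitude_definite by (rule integral_curve_conjugacy)
qed

text \<open>
  For the parameter \<open>-A y\<close> the level set of \<open>A\<close> through \<open>y\<close> is compact and invariant, and it
  contains \<open>y\<close> and \<open>-y\<close>. The preimage of at least one of these under an equivalence is not the
  origin, so its orbit for the parameter 0 blows up while staying in the compact preimage of the
  level set.
\<close>
lemma not_orbitally_equivalent_zero:
  assumes y: "y \<in> coord_subspace L" "y \<noteq> 0"
  shows "\<not> orbitally_equivalent (coord_subspace L) (normal_form \<omega> a 0) (normal_form \<omega> a (- amplitude a y))"
proof
  let ?S = "coord_subspace L" and ?\<mu> = "- amplitude a y"
  assume "orbitally_equivalent ?S (normal_form \<omega> a 0) (normal_form \<omega> a ?\<mu>)"
  then obtain h h' where hom: "homeomorphism ?S ?S h h'"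
    and carries: "carries_orbits ?S (normal_form \<omega> a 0) (normal_form \<omega> a ?\<mu>) h"
    unfolding orbitally_equivalent_def by blast
  define K where "K = {x \<in> ?S. amplitude a x = amplitude a y}"
  have "y \<in> K" using y by (simp add: K_def)
  have "(- 1) *\<^sub>R y \<in> K"
    unfolding K_def using scaleR_coord_subspace[OF y(1), of "- 1"] amplitude_scaleR[of a "- 1" y] by simp
  then have "- y \<in> K" by simp
  have "y \<noteq> - y"
  proof
    assume "y = - y"
    then have "2 *\<^sub>R y = 0" by (metis add.right_inverse scaleR_2)
    with y(2) show False by simp
  qed
  \<comment> \<open>At most one of the two points can correspond to the rest point at the origin.\<close>
  have "h' y \<noteq> h' (- y)"
    using \<open>y \<in> K\<close> \<open>- y \<in> K\<close> \<open>y \<noteq> - y\<close> homeomorphism_apply2[OF hom] unfolding K_def by (metis (lifting) mem_Collect_eq)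
  then obtain z where z: "z \<in> K" "h' z \<noteq> 0" using \<open>y \<in> K\<close> \<open>- y \<in> K\<close> by metis
  define x where "x = h' z"
  have zS: "z \<in> ?S" using z by (simp add: K_def)
  have x: "x \<in> ?S" using hom zS by (auto simp: x_def homeomorphism_def)
  have hx: "h x = z" unfolding x_def by (rule homeomorphism_apply2[OF hom zS])
  define A where "A = amplitude a x"
  have A0: "A \<noteq> 0" using amplitude_definite[OF x] z(2) by (auto simp: A_def x_def)
  define I where "I = {t. 0 < 1 - 2 * A * t}"
  define \<gamma> where "\<gamma> = blow_up_curve \<omega> a x"
  have max: "maximal_integral_curve ?S (normal_form \<omega> a 0) I \<gamma>"
    unfolding I_def A_def \<gamma>_def
    by (rule maximal_blow_up_curve) (use x A0 in \<open>auto simp: A_def scaleR_coord_subspace rotation_coord_subspace\<close>)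
  then obtain J \<delta> \<tau> where \<delta>: "maximal_integral_curve ?S (normal_form \<omega> a ?\<mu>) J \<delta>"
    and \<tau>: "\<tau> ` I = J" "\<forall>t\<in>I. h (\<gamma> t) = \<delta> (\<tau> t)"
    using carries unfolding carries_orbits_def by blast
  have \<delta>': "integral_curve ?S (normal_form \<omega> a ?\<mu>) J \<delta>" using \<delta> by (simp add: maximal_integral_curve_def)
  have I0: "0 \<in> I" by (simp add: I_def)
  have "\<gamma> 0 = x" by (simp add: \<gamma>_def blow_up_curve_def rotation_def vec_eq_iff)
  then have start: "amplitude a (\<delta> (\<tau> 0)) = - ?\<mu>" using \<tau>(2) I0 hx z by (auto simp: K_def)
  have inK: "\<gamma> t \<in> h' ` K" if t: "t \<in> I" for t
  proof -
    have "\<tau> 0 \<in> J" "\<tau> t \<in> J" using \<tau>(1) I0 t by auto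
    then have "\<delta> (\<tau> t) \<in> K"
      using amplitude_equilibrium_invariant[OF \<delta>' _ _ start] \<delta>' by (auto simp: K_def integral_curve_def)
    moreover have "\<gamma> t \<in> ?S" using max t by (simp add: maximal_integral_curve_def integral_curve_def)
    then have "\<gamma> t = h' (\<delta> (\<tau> t))" using \<tau>(2) t homeomorphism_apply1[OF hom] by metis
    ultimately show ?thesis by blast
  qed
  have "compact (amplitude a ` h' ` K)"
  proof (intro compact_continuous_image continuous_on_amplitude)
    show "continuous_on K h'"
      using hom by (auto simp: homeomorphism_def K_def intro: continuous_on_subset)
    show "compact K" unfolding K_def by (rule compact_amplitude_level)
  qed
  then obtain M where M: "\<And>w. w \<in> h' ` K \<Longrightarrow> \<bar>amplitude a w\<bar> \<le> M"
    by (metis (no_types, lifting) bounded_iff compact_imp_bounded image_eqI real_norm_def)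
  \<comment> \<open>At this time the blow-up curve has amplitude \<open>\<plusminus>(M + 1)\<close>.\<close>
  have M0: "0 < M + 1" using M[OF inK[OF I0]] by linarith
  define t where "t = (1 - \<bar>A\<bar> / (M + 1)) / (2 * A)"
  have q: "1 - 2 * A * t = \<bar>A\<bar> / (M + 1)" using A0 by (simp add: t_def)
  then have q0: "0 < 1 - 2 * A * t" using A0 M0 by simp
  have "\<bar>A\<bar> / (M + 1) * amplitude a (\<gamma> t) = A"
    using amplitude_blow_up_curve[of a x t \<omega>] q0 by (simp add: A_def \<gamma>_def flip: q[unfolded A_def])
  then have "\<bar>A\<bar> / (M + 1) * \<bar>amplitude a (\<gamma> t)\<bar> = \<bar>A\<bar>"
    using M0 by (metis abs_abs abs_divide abs_mult abs_of_pos)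
  then have "\<bar>A\<bar> * \<bar>amplitude a (\<gamma> t)\<bar> = \<bar>A\<bar> * (M + 1)" using M0 by (simp add: field_simps)
  then have "\<bar>amplitude a (\<gamma> t)\<bar> = M + 1" using A0 by (simp only: mult_cancel_left abs_eq_0 simp_thms)
  moreover have "t \<in> I" using q0 by (simp add: I_def)
  ultimately show False using M[OF inK] by fastforce
qed

text \<open>
  Nonzero parameters are structurally stable since their sign is locally constant; at 0, the
  parameters \<open>-A y\<close> with \<open>y\<close> tending to the origin violate equivalence arbitrarily close by.
\<close>
lemma bifurcation_variety_normal_form:
  assumes "L \<noteq> {}"
  shows "bifurcation_variety (coord_subspace L) (normal_form \<omega> a) = {0}"
proof -
  let ?equiv = "\<lambda>\<nu> \<mu>. orbitally_equivalent (coord_subspace L) (normal_form \<omega> a \<nu>) (normal_form \<omega> a \<mu>)"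
  have "\<forall>\<^sub>F \<mu> in nhds \<nu>. ?equiv \<nu> \<mu>" if "\<nu> \<noteq> 0" for \<nu>
  proof -
    have "((\<lambda>\<mu>. \<nu> * \<mu>) \<longlongrightarrow> \<nu> * \<nu>) (nhds \<nu>)" by (intro tendsto_intros filterlim_ident)
    moreover have "0 < \<nu> * \<nu>" using that by (simp add: zero_less_mult_iff linorder_neq_iff) argo
    ultimately have "\<forall>\<^sub>F \<mu> in nhds \<nu>. 0 < \<nu> * \<mu>" by (rule order_tendstoD(1))
    then show ?thesis by eventually_elim (rule orbitally_equivalent_same_sign)
  qed
  moreover have "\<not> (\<forall>\<^sub>F \<mu> in nhds 0. ?equiv 0 \<mu>)"
  proof
    assume ev: "\<forall>\<^sub>F \<mu> in nhds 0. ?equiv 0 \<mu>"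
    obtain j where "j \<in> L" using assms by blast
    define x where "x = axis j (1 :: real, 0 :: real)"
    have x: "x \<in> coord_subspace L" "x \<noteq> 0"
      using \<open>j \<in> L\<close> by (auto simp: x_def coord_subspace_def axis_def vec_eq_iff zero_prod_def)
    define y where "y m = inverse (real (Suc m)) *\<^sub>R x" for m
    have "(\<lambda>m. - ((inverse (real (Suc m)))\<^sup>2 * amplitude a x)) \<longlonglongrightarrow> - (0\<^sup>2 * amplitude a x)"
      by (intro tendsto_intros LIMSEQ_inverse_real_of_nat)
    then have "(\<lambda>m. - amplitude a (y m)) \<longlonglongrightarrow> 0" by (simp add: y_def amplitude_scaleR del: of_nat_Suc)
    from eventually_compose_filterlim[OF ev this]
    have "\<forall>\<^sub>F m in sequentially. ?equiv 0 (- amplitude a (y m))" .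
    then obtain m where "?equiv 0 (- amplitude a (y m))" by (auto simp: eventually_sequentially)
    moreover have "y m \<in> coord_subspace L" "y m \<noteq> 0"
      using x by (simp_all add: y_def scaleR_coord_subspace del: of_nat_Suc)
    ultimately show False using not_orbitally_equivalent_zero by blast
  qed
  ultimately show ?thesis by (auto simp: bifurcation_variety_def)
qed

end

section \<open>Bifurcation of the cell system\<close>

text \<open>
  For two different indices the sign condition applies directly. For a single index it says nothing
  unless there is a second one; the cubic case then excludes a zero coefficient.
\<close>
lemma definite_amplitude_cell:
  fixes \<sigma> :: "'n::{finite,linorder} \<Rightarrow> 'n"
  assumes sgn: "\<And>i j. i < j \<Longrightarrow> pos j \<le> k \<Longrightarrow> sgn (a (\<sigma> j) * a (\<sigma> i)) = 1"
    and cubic: "cubic_case a k \<sigma>"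
  shows "definite_amplitude a (\<sigma> ` {i. pos i \<le> k})"
proof
  have distinct: "0 < a (\<sigma> i) * a (\<sigma> j)" if "pos i \<le> k" "pos j \<le> k" "i \<noteq> j" for i j
    using sgn[of i j] sgn[of j i] that by (cases "i < j") (auto simp: sgn_1_pos mult.commute)
  have nonzero: "a (\<sigma> i) \<noteq> 0" if i: "pos i \<le> k" for i
  proof
    assume zero: "a (\<sigma> i) = 0"
    then have "{i. pos i \<le> k} = {i}" using distinct[OF _ i] i by fastforce
    then have "leaf_cubic_coeff a k \<sigma> (\<lambda>_. 1) = 0" using zero by (simp add: leaf_cubic_coeff_def)
    then show False using cubic by (simp add: cubic_case_def)
  qed
  fix i j assume "i \<in> \<sigma> ` {i. pos i \<le> k}" "j \<in> \<sigma> ` {i. pos i \<le> k}"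
  then obtain i' j' where ij: "i = \<sigma> i'" "j = \<sigma> j'" "pos i' \<le> k" "pos j' \<le> k" by blast
  show "0 < a i * a j"
  proof (cases "i' = j'")
    case True
    have "a i * a i \<noteq> 0" using nonzero[OF ij(3)] ij(1) by simp
    then show ?thesis using True ij by (simp add: less_le)
  qed (use distinct ij in auto)
qed

theorem theorem6p9:
  fixes k :: nat
    and \<sigma> :: "'n::{finite,linorder} \<Rightarrow> 'n"
    and a \<omega> :: "'n \<Rightarrow> real"
  assumes "1 < k" "k \<le> CARD('n)"
    and "\<sigma> \<in> block_increasing_perms k"
    and "\<And>i j. i < j \<Longrightarrow> pos j \<le> k \<Longrightarrow> sgn (a (\<sigma> j) * a (\<sigma> i)) = 1"
    and "cubic_case a k \<sigma>"
    and "\<And>i. \<omega> i \<noteq> 0"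
    and "\<And>i j. i < j \<Longrightarrow> \<omega> i / \<omega> j \<notin> \<rat>"
  shows "(\<forall>\<nu>1 \<nu>2. (\<nu>1 > 0 \<and> \<nu>2 > 0) \<or> (\<nu>1 < 0 \<and> \<nu>2 < 0) \<longrightarrow>
            orbitally_equivalent (closure (cell k \<sigma>)) (vfield a \<nu>1) (vfield a \<nu>2))
       \<and> bifurcation_variety (closure (cell k \<sigma>)) (vfield a) = {0}
       \<and> bifurcation_variety (closure (cell k \<sigma>)) (\<lambda>\<nu> x. Theta \<omega> x + vfield a \<nu> x) = {0}"
proof -
  define L where "L = \<sigma> ` {i. pos i \<le> k}"
  have closure: "closure (cell k \<sigma>) = coord_subspace L"
    unfolding L_def using assms(3) by (intro closure_cell) (simp add: block_increasing_perms_def)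
  interpret definite_amplitude a L
    unfolding L_def using assms(4,5) by (rule definite_amplitude_cell)
  have "L \<noteq> {}"
  proof
    assume "L = {}"
    then have "leaf_cubic_coeff a k \<sigma> (\<lambda>_. 1) = 0" by (simp add: L_def leaf_cubic_coeff_def)
    then show False using assms(5) by (simp add: cubic_case_def)
  qed
  have no_rotation: "normal_form (\<lambda>_. 0) a = vfield a"
    by (simp add: fun_eq_iff normal_form_no_rotation)
  have rotation: "normal_form \<omega> a = (\<lambda>\<nu> x. Theta \<omega> x + vfield a \<nu> x)"
    by (simp add: fun_eq_iff normal_form_def)
  have "orbitally_equivalent (coord_subspace L) (vfield a \<nu>1) (vfield a \<nu>2)"
    if "(\<nu>1 > 0 \<and> \<nu>2 > 0) \<or> (\<nu>1 < 0 \<and> \<nu>2 < 0)" for \<nu>1 \<nu>2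
    using orbitally_equivalent_same_sign[of \<nu>1 \<nu>2 "\<lambda>_. 0"] that
    by (simp add: normal_form_no_rotation zero_less_mult_iff)
  then show ?thesis
    using bifurcation_variety_normal_form[OF \<open>L \<noteq> {}\<close>, of "\<lambda>_. 0"]
      bifurcation_variety_normal_form[OF \<open>L \<noteq> {}\<close>, of \<omega>]
    by (simp add: closure no_rotation rotation)
qed

end
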